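(* A real Banach space $B$ is strictly convex if and only if $\mathcal{J}(x)=\{x\}$ for every $x\in B$.
   Context: $B^*$ is the dual of $B$ and $\langle\cdot,\cdot\rangle$ is the pairing between $B^*$ and $B$. The normalized duality map is $J(x)=\{\psi\in B^*:\langle\psi,x\rangle=\|\psi\|\|x\|=\|x\|^2=\|\psi\|^2\}$ for $x\in B$. The set of generalized identical points of $x\in B$ is $\mathcal{J}(x)=\{y\in B: J(x)\cap J(y)\neq\emptyset\}$. *)

theory Defs
  imports "HOL-Analysis.Analysis"
begin

text \<open>The dual of \<open>'a\<close> is the type \<^typ>\<open>'a::real_normed_vector \<Rightarrow>\<^sub>L real\<close>
  of bounded linear functionals, with the operator norm.\<close>

definition duality_map :: "'a::real_normed_vector \<Rightarrow> ('a \<Rightarrow>\<^sub>L real) set" where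
  "duality_map x = {\<psi>. blinfun_apply \<psi> x = norm \<psi> * norm x
     \<and> norm \<psi> * norm x = (norm x)\<^sup>2 \<and> (norm x)\<^sup>2 = (norm \<psi>)\<^sup>2}"

definition generalized_identical_points :: "'a::real_normed_vector \<Rightarrow> 'a set" where
  "generalized_identical_points x = {y. duality_map x \<inter> duality_map y \<noteq> {}}"

text \<open>Strict convexity is a property of the whole space, hence of a type. It is the usual
  condition that the open segment joining two distinct unit vectors lies in the open unit ball.\<close>

definition strictly_convex :: "'a::real_normed_vector itself \<Rightarrow> bool" where
  "strictly_convex (_ :: 'a itself) \<longleftrightarrow>
     (\<forall>(x::'a) y t. norm x = 1 \<and> norm y = 1 \<and> x \<noteq> y \<and> 0 < t \<and> t < 1
        \<longrightarrow> norm ((1 - t) *\<^sub>R x + t *\<^sub>R y) < 1)"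

end

theory Submission
  imports Defs
begin

text \<open>The equality \<open>\<J>(x) = {x}\<close> contains the claim that \<open>J(x)\<close> is nonempty, which is the
  Hahn--Banach theorem. It is obtained by Zorn's lemma in the lattice of sublinear functionals:
  a minimal sublinear functional is linear, because \<open>q\<close> dominates the sublinear functional
  \<open>y \<mapsto> inf {q (y + t x) - t q x | t \<ge> 0}\<close>, so minimality forces \<open>q y \<le> q (y + x) - q x\<close>.

  A functional in \<open>J(x) \<inter> J(y)\<close> attains its norm at \<open>x\<close>, at \<open>y\<close> and on the segment joining them,
  so strict convexity gives \<open>x = y\<close>. Conversely, if \<open>z\<close> is a unit vector in the open segment
  between unit vectors \<open>x\<close> and \<open>y\<close>, then an element of \<open>J(z)\<close> also lies in \<open>J(x)\<close> and \<open>J(y)\<close>.\<close>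

section \<open>Sublinear functionals\<close>

definition sublinear :: "('a::real_vector \<Rightarrow> real) \<Rightarrow> bool" where
  "sublinear p \<longleftrightarrow> (\<forall>x y. p (x + y) \<le> p x + p y) \<and> (\<forall>c\<ge>0. \<forall>x. p (c *\<^sub>R x) = c * p x)"

lemma sublinear_add: "sublinear p \<Longrightarrow> p (x + y) \<le> p x + p y"
  by (simp add: sublinear_def)

lemma sublinear_scale: "sublinear p \<Longrightarrow> 0 \<le> c \<Longrightarrow> p (c *\<^sub>R x) = c * p x"
  by (simp add: sublinear_def)

lemma sublinear_zero: "sublinear p \<Longrightarrow> p 0 = 0"
  using sublinear_scale[of p 0 0] by simp

lemma sublinear_minus_ge: "sublinear p \<Longrightarrow> - p (- x) \<le> p x"
  using sublinear_add[of p x "- x"] sublinear_zero[of p] by simp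

lemma sublinearI:
  assumes add: "\<And>x y. p (x + y) \<le> p x + p y"
    and scale: "\<And>c x. 0 < c \<Longrightarrow> p (c *\<^sub>R x) \<le> c * p x"
  shows "sublinear p"
proof -
  have "p 0 = 0"
    \<comment> \<open>Additivity gives \<open>0 \<le> p 0\<close>, and the factor \<open>1/2\<close>
      gives \<open>p 0 \<le> p 0 / 2\<close>.\<close>
    using add[of 0 0] scale[of "1/2" 0] by simp
  moreover have "p (c *\<^sub>R x) = c * p x" if "0 < c" for c x
  proof (rule antisym)
    have "p x \<le> inverse c * p (c *\<^sub>R x)"
      using scale[of "inverse c" "c *\<^sub>R x"] that by simp
    then show "c * p x \<le> p (c *\<^sub>R x)"
      using that by (simp add: field_simps)
  qed (rule scale[OF that])
  ultimately have "p (c *\<^sub>R x) = c * p x" if "0 \<le> c" for c x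
    using that by (cases "c = 0") auto
  then show ?thesis
    using add by (simp add: sublinear_def)
qed

lemma sublinear_norm: "sublinear (norm :: 'a::real_normed_vector \<Rightarrow> real)"
  by (rule sublinearI) (auto intro: norm_triangle_ineq)

lemma linear_if_sublinear_superadditive:
  assumes p: "sublinear p" and super: "\<And>x y. p x + p y \<le> p (x + y)"
  shows "linear p"
proof -
  have add: "p (x + y) = p x + p y" for x y
    using sublinear_add[OF p] super by (rule antisym)
  have minus: "p (- x) = - p x" for x
    using add[of x "- x"] sublinear_zero[OF p] by simp
  have "p (c *\<^sub>R x) = c * p x" for c x
  proof (cases "0 \<le> c")
    case False
    then show ?thesis
      using sublinear_scale[OF p, of "- c" x] minus[of "c *\<^sub>R x"] by simp
  qed (rule sublinear_scale[OF p])
  then show ?thesis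
    using add by (intro linearI) auto
qed

text \<open>The infima are taken one after the other, each as a greatest lower bound. This yields
  subadditivity of functionals defined by infima.\<close>

lemma le_cINF_add:
  fixes a :: real
  assumes "I \<noteq> {}" "J \<noteq> {}" and le: "\<And>i j. i \<in> I \<Longrightarrow> j \<in> J \<Longrightarrow> a \<le> f i + g j"
  shows "a \<le> (INF i\<in>I. f i) + (INF j\<in>J. g j)"
proof -
  have "a - f i \<le> (INF j\<in>J. g j)" if "i \<in> I" for i
    using le[OF that] by (intro cINF_greatest assms) (simp add: algebra_simps)
  then have "a - (INF j\<in>J. g j) \<le> (INF i\<in>I. f i)"
    by (intro cINF_greatest assms) (simp add: algebra_simps)
  then show ?thesis by simp
qed

lemma le_mult_cINF:
  fixes a c :: real
  assumes "I \<noteq> {}" "0 < c" and le: "\<And>i. i \<in> I \<Longrightarrow> a \<le> c * f i"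
  shows "a \<le> c * (INF i\<in>I. f i)"
proof -
  have "a / c \<le> (INF i\<in>I. f i)"
    using le assms(2) by (intro cINF_greatest assms(1)) (simp add: field_simps)
  then show ?thesis
    using assms(2) by (simp add: field_simps)
qed

text \<open>For sublinear \<open>p\<close> this is the largest sublinear \<open>r \<le> p\<close>
  with \<open>r (- x) \<le> - p x\<close>.\<close>

definition sublinear_lowering :: "('a::real_vector \<Rightarrow> real) \<Rightarrow> 'a \<Rightarrow> 'a \<Rightarrow> real" where
  "sublinear_lowering p x y = (INF t\<in>{0..}. p (y + t *\<^sub>R x) - t * p x)"

lemma sublinear_lowering_le:
  assumes p: "sublinear p" and "0 \<le> t"
  shows "sublinear_lowering p x y \<le> p (y + t *\<^sub>R x) - t * p x"
proof -
  \<comment> \<open>A lower bound uniform in the parameter, so that the infimum is a genuine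
    one.\<close>
  have "- p (- y) \<le> p (y + s *\<^sub>R x) - s * p x" if "0 \<le> s" for s
    using sublinear_add[OF p, of "y + s *\<^sub>R x" "- y"] sublinear_scale[OF p that, of x] by simp
  then have "bdd_below ((\<lambda>t. p (y + t *\<^sub>R x) - t * p x) ` {0..})"
    by (intro bdd_belowI2[of _ "- p (- y)"]) auto
  then show ?thesis
    unfolding sublinear_lowering_def using assms(2) by (intro cINF_lower) auto
qed

lemma sublinear_lowering_le_self: "sublinear p \<Longrightarrow> sublinear_lowering p x y \<le> p y"
  using sublinear_lowering_le[of p 0 x y] by simp

text \<open>Parameters \<open>s\<close> for \<open>y\<close> and \<open>t\<close> for
  \<open>z\<close> combine to \<open>s + t\<close> for \<open>y + z\<close>; a parameter
  \<open>t\<close> for \<open>y\<close> becomes \<open>c * t\<close> for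
  \<open>c *\<^sub>R y\<close>.\<close>

lemma sublinear_sublinear_lowering:
  assumes p: "sublinear p"
  shows "sublinear (sublinear_lowering p x)"
proof (rule sublinearI)
  fix y z
  have "sublinear_lowering p x (y + z) \<le>
      (p (y + s *\<^sub>R x) - s * p x) + (p (z + t *\<^sub>R x) - t * p x)" if "0 \<le> s" "0 \<le> t" for s t
    using sublinear_lowering_le[OF p, of "s + t" x "y + z"]
      sublinear_add[OF p, of "y + s *\<^sub>R x" "z + t *\<^sub>R x"] that
    by (simp add: algebra_simps)
  then show "sublinear_lowering p x (y + z) \<le> sublinear_lowering p x y + sublinear_lowering p x z"
    unfolding sublinear_lowering_def[of p x y] sublinear_lowering_def[of p x z]
    by (intro le_cINF_add) auto
next
  fix c :: real and y
  assume c: "0 < c"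
  have "sublinear_lowering p x (c *\<^sub>R y) \<le> c * (p (y + t *\<^sub>R x) - t * p x)" if "0 \<le> t" for t
    using sublinear_lowering_le[OF p, of "c * t" x "c *\<^sub>R y"]
      sublinear_scale[OF p, of c "y + t *\<^sub>R x"] that c
    by (simp add: algebra_simps)
  then show "sublinear_lowering p x (c *\<^sub>R y) \<le> c * sublinear_lowering p x y"
    unfolding sublinear_lowering_def[of p x y] using c by (intro le_mult_cINF) auto
qed

text \<open>Supplies the lower bounds of chains for Zorn's lemma. The pointwise infimum is finite
  because every member satisfies \<open>q x \<ge> - q (- x) \<ge> - p (- x)\<close>.\<close>

lemma sublinear_chain_INF:
  fixes C :: "('a::real_vector \<Rightarrow> real) set"
  assumes "C \<noteq> {}" and sub: "\<And>q. q \<in> C \<Longrightarrow> sublinear q" and bound: "\<And>q. q \<in> C \<Longrightarrow> q \<le> p"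
    and chain: "\<And>q r. q \<in> C \<Longrightarrow> r \<in> C \<Longrightarrow> q \<le> r \<or> r \<le> q"
  shows "sublinear (\<lambda>x. INF q\<in>C. q x)"
    and "q \<in> C \<Longrightarrow> (\<lambda>x. INF q\<in>C. q x) \<le> q"
proof -
  have "- p (- x) \<le> q x" if "q \<in> C" for q x
    using sublinear_minus_ge[OF sub[OF that], of x] le_funD[OF bound[OF that], of "- x"] by simp
  then have "bdd_below ((\<lambda>q. q x) ` C)" for x
    by (intro bdd_belowI2[of _ "- p (- x)"]) auto
  then have lower: "(INF q\<in>C. q x) \<le> q x" if "q \<in> C" for q x
    using that by (rule cINF_lower)
  show "(\<lambda>x. INF q\<in>C. q x) \<le> q" if "q \<in> C"
    using lower[OF that] by (rule le_funI)
  show "sublinear (\<lambda>x. INF q\<in>C. q x)"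
  proof (rule sublinearI)
    fix x y
    have "(INF q\<in>C. q (x + y)) \<le> q x + r y" if qr: "q \<in> C" "r \<in> C" for q r
    proof -
      \<comment> \<open>The smaller of \<open>q\<close> and \<open>r\<close> serves at both points;
        this is where the chain condition enters.\<close>
      obtain s where "s \<in> C" "s \<le> q" "s \<le> r"
        using chain[OF qr] qr by blast
      then show ?thesis
        using lower[of s "x + y"] sublinear_add[OF sub, of s x y] le_funD[of s q x] le_funD[of s r y]
        by linarith
    qed
    then show "(INF q\<in>C. q (x + y)) \<le> (INF q\<in>C. q x) + (INF q\<in>C. q y)"
      by (intro le_cINF_add assms(1))
  next
    fix c :: real and x
    assume c: "0 < c"
    have "(INF q\<in>C. q (c *\<^sub>R x)) \<le> c * q x" if "q \<in> C" for q
      using lower[OF that, of "c *\<^sub>R x"] sublinear_scale[OF sub[OF that], of c x] c by simp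
    then show "(INF q\<in>C. q (c *\<^sub>R x)) \<le> c * (INF q\<in>C. q x)"
      using c by (intro le_mult_cINF assms(1))
  qed
qed

lemma ex_minimal_sublinear:
  assumes p: "sublinear p"
  obtains q where "sublinear q" "q \<le> p" "\<And>r. sublinear r \<Longrightarrow> r \<le> q \<Longrightarrow> r = q"
proof -
  let ?A = "{q. sublinear q \<and> q \<le> p}"
  \<comment> \<open>Zorn's lemma for the reversed order. Minimality within \<open>?A\<close> is
    minimality among all sublinear functionals, since whatever lies below \<open>m\<close> lies
    below \<open>p\<close>.\<close>
  have "\<exists>m\<in>?A. \<forall>q\<in>?A. m \<ge> q \<longrightarrow> q = m"
  proof (rule predicate_Zorn)
    show "partial_order_on ?A (relation_of (\<ge>) ?A)"
      by (rule partial_order_on_relation_ofI) auto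
  next
    fix C
    assume C: "C \<in> Chains (relation_of (\<ge>) ?A)"
    then have mem: "sublinear q" "q \<le> p" if "q \<in> C" for q
      using that by (auto simp: Chains_def relation_of_def)
    have chain: "q \<le> r \<or> r \<le> q" if "q \<in> C" "r \<in> C" for q r
      using C that unfolding Chains_def relation_of_def by blast
    show "\<exists>u\<in>?A. \<forall>q\<in>C. q \<ge> u"
    proof (cases "C = {}")
      case False
      let ?u = "\<lambda>x. INF q\<in>C. q x"
      have "sublinear ?u"
        using False mem chain by (rule sublinear_chain_INF)
      moreover have u: "?u \<le> q" if "q \<in> C" for q
        using False mem chain that by (rule sublinear_chain_INF)
      moreover have "?u \<le> p"
        using False mem(2) u by (meson all_not_in_conv order_trans)
      ultimately show ?thesis by blast
    qed (use p in auto)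
  qed
  then show ?thesis
    using that order_trans by blast
qed

text \<open>Minimizing below \<open>sublinear_lowering p a\<close> rather than below
  \<open>p\<close> controls the value at \<open>a\<close>: the parameter \<open>1\<close> gives
  \<open>q (- a) \<le> p 0 - p a\<close>, which linearity turns into
  \<open>p a \<le> q a\<close>.\<close>

theorem Hahn_Banach_sublinear:
  assumes p: "sublinear p"
  obtains f where "linear f" "\<And>x. f x \<le> p x" "f a = p a"
proof -
  obtain q where q: "sublinear q" "q \<le> sublinear_lowering p a"
    and minimal: "\<And>r. sublinear r \<Longrightarrow> r \<le> q \<Longrightarrow> r = q"
    using ex_minimal_sublinear[OF sublinear_sublinear_lowering[OF p]] by metis
  have "sublinear_lowering q x = q" for x
    by (intro minimal sublinear_sublinear_lowering le_funI sublinear_lowering_le_self q)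
  then have "q x + q y \<le> q (x + y)" for x y
    using sublinear_lowering_le[OF q(1), of 1 x y] by (simp add: add.commute)
  then have "linear q"
    by (rule linear_if_sublinear_superadditive[OF q(1)])
  moreover have le: "q x \<le> p x" for x
    using le_funD[OF q(2)] sublinear_lowering_le_self[OF p] by (rule order_trans)
  moreover have "q (- a) \<le> - p a"
    using le_funD[OF q(2), of "- a"] sublinear_lowering_le[OF p, of 1 a "- a"] sublinear_zero[OF p]
    by simp
  then have "q a = p a"
    using le[of a] linear_neg[OF \<open>linear q\<close>, of a] by simp
  ultimately show ?thesis
    using that by blast
qed

section \<open>The duality map\<close>

text \<open>Norms are nonnegative, so equal squares mean equal norms, and both products become
  \<open>norm x * norm x\<close>.\<close>

lemma mem_duality_map_iff:
  "\<psi> \<in> duality_map x \<longleftrightarrow> norm \<psi> = norm x \<and> blinfun_apply \<psi> x = norm x * norm x"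
proof -
  have "(norm x)\<^sup>2 = (norm \<psi>)\<^sup>2 \<longleftrightarrow> norm \<psi> = norm x"
    by (metis norm_ge_zero power2_eq_imp_eq)
  then show ?thesis
    unfolding duality_map_def mem_Collect_eq by (metis power2_eq_square)
qed

lemma blinfun_apply_le_norm: "blinfun_apply \<psi> x \<le> norm \<psi> * norm x"
  for \<psi> :: "'a::real_normed_vector \<Rightarrow>\<^sub>L real"
  using norm_blinfun[of \<psi> x] by simp

lemma duality_map_nonempty: "duality_map x \<noteq> {}"
proof -
  obtain f where f: "linear f" "\<And>y. f y \<le> norm y" "f x = norm x"
    using Hahn_Banach_sublinear[OF sublinear_norm] by metis
  have abs_f: "\<bar>f y\<bar> \<le> norm y" for y
    using f(2)[of y] f(2)[of "- y"] linear_neg[OF f(1), of y] by simp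
  have "bounded_linear f"
    by (intro bounded_linear.intro f(1) bounded_linear_axioms.intro exI[of _ 1])
      (simp add: abs_f)
  then have apply_f: "blinfun_apply (Blinfun f) = f"
    by (rule bounded_linear_Blinfun_apply)
  have "norm (Blinfun f) \<le> 1"
    by (rule norm_blinfun_bound) (simp_all add: apply_f abs_f)
  \<comment> \<open>The norm is attained at \<open>x\<close>. For \<open>x = 0\<close> the factor
    \<open>norm x\<close> below produces the zero functional, which lies in
    \<open>duality_map 0\<close>.\<close>
  moreover have "1 \<le> norm (Blinfun f)" if "x \<noteq> 0"
    using blinfun_apply_le_norm[of "Blinfun f" x] that by (simp add: apply_f f(3))
  ultimately have "norm x *\<^sub>R Blinfun f \<in> duality_map x"
    by (cases "x = 0") (auto simp: mem_duality_map_iff apply_f f(3) scaleR_blinfun.rep_eq)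
  then show ?thesis by blast
qed

lemma strictly_convex_duality_map_disjoint:
  fixes x y :: "'a::real_normed_vector"
  assumes sc: "strictly_convex TYPE('a)" and x: "\<psi> \<in> duality_map x" and y: "\<psi> \<in> duality_map y"
  shows "x = y"
proof (rule ccontr)
  assume "x \<noteq> y"
  define r where "r = norm \<psi>"
  have r: "norm x = r" "norm y = r" "blinfun_apply \<psi> x = r * r" "blinfun_apply \<psi> y = r * r"
    using x y by (auto simp: mem_duality_map_iff r_def)
  with \<open>x \<noteq> y\<close> have "0 < r"
    by (metis norm_ge_zero norm_eq_zero order_le_less)
  \<comment> \<open>The midpoint of the normalized vectors, written in the shape of
    \<open>strictly_convex\<close> at \<open>t = 1/2\<close>. There \<open>\<psi>\<close> takes the
    value \<open>r\<close>, its own norm, so \<open>?z\<close> cannot lie in the open unit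
    ball.\<close>
  let ?z = "(1 - 1/2) *\<^sub>R (x /\<^sub>R r) + (1/2) *\<^sub>R (y /\<^sub>R r)"
  have "norm ?z < 1"
    using sc \<open>x \<noteq> y\<close> \<open>0 < r\<close> r(1,2) unfolding strictly_convex_def
    by (elim allE[of _ "x /\<^sub>R r"] allE[of _ "y /\<^sub>R r"] allE[of _ "1/2"]) simp
  moreover have "blinfun_apply \<psi> ?z = r"
    using r(3,4) \<open>0 < r\<close> by (simp add: blinfun.add_right blinfun.scaleR_right field_simps)
  then have "r * 1 \<le> r * norm ?z"
    using blinfun_apply_le_norm[of \<psi> ?z] unfolding r_def by simp
  ultimately show False
    using \<open>0 < r\<close> by simp
qed

theorem proposition4p3:
  shows "strictly_convex TYPE('a::banach) \<longleftrightarrow>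
    (\<forall>x::'a. generalized_identical_points x = {x})"
proof
  assume "strictly_convex TYPE('a)"
  \<comment> \<open>Nonemptiness of \<open>duality_map x\<close> puts \<open>x\<close> into the set;
    the preceding lemma excludes every other point.\<close>
  then show "\<forall>x::'a. generalized_identical_points x = {x}"
    using duality_map_nonempty strictly_convex_duality_map_disjoint
    unfolding generalized_identical_points_def by blast
next
  assume J: "\<forall>x::'a. generalized_identical_points x = {x}"
  show "strictly_convex TYPE('a)"
    unfolding strictly_convex_def
  proof (intro allI impI, elim conjE, rule ccontr)
    fix x y :: 'a and t :: real
    assume x: "norm x = 1" and y: "norm y = 1" and "x \<noteq> y" and t: "0 < t" "t < 1"
    define z where "z = (1 - t) *\<^sub>R x + t *\<^sub>R y"
    assume "\<not> norm ((1 - t) *\<^sub>R x + t *\<^sub>R y) < 1"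
    moreover have "norm z \<le> 1"
      using norm_triangle_ineq[of "(1 - t) *\<^sub>R x" "t *\<^sub>R y"] x y t by (simp add: z_def)
    ultimately have z: "norm z = 1"
      by (simp add: z_def)
    obtain \<psi> where \<psi>: "\<psi> \<in> duality_map z"
      using duality_map_nonempty by blast
    then have norm_\<psi>: "norm \<psi> = 1"
      and \<psi>_z: "(1 - t) * blinfun_apply \<psi> x + t * blinfun_apply \<psi> y = 1"
      using z by (auto simp: mem_duality_map_iff z_def blinfun.add_right blinfun.scaleR_right)
    have le: "blinfun_apply \<psi> x \<le> 1" "blinfun_apply \<psi> y \<le> 1"
      using blinfun_apply_le_norm[of \<psi> x] blinfun_apply_le_norm[of \<psi> y] norm_\<psi> x y by auto
    \<comment> \<open>A sum of nonnegative terms with positive weights vanishes only if both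
      brackets do, so \<open>\<psi>\<close> attains its norm at both endpoints.\<close>
    have "(1 - t) * (1 - blinfun_apply \<psi> x) + t * (1 - blinfun_apply \<psi> y) = 0"
      using \<psi>_z by (simp add: algebra_simps)
    then have "blinfun_apply \<psi> x = 1" "blinfun_apply \<psi> y = 1"
      using le t by (simp_all add: add_nonneg_eq_0_iff)
    then have "\<psi> \<in> duality_map x" "\<psi> \<in> duality_map y"
      using norm_\<psi> x y by (simp_all add: mem_duality_map_iff)
    then have "y \<in> generalized_identical_points x"
      by (auto simp: generalized_identical_points_def)
    with J \<open>x \<noteq> y\<close> show False by simp
  qed
qed

end
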